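(* Let $R$ be an elementary divisor domain and let $f(t),g(t)\in R[t]$ be coprime polynomials, with $g(t)$ monic of degree $n\ge 1$. Let $q(t)\in R[t]$ be the unique polynomial of degree less than $n$ such that $f(t)q(t)\equiv \operatorname{Res}(f,g) \bmod g(t)$. Then (up to units of $R$) $\gamma_{n-1}(f(C_g))=\operatorname{cont}(q(t))$. In particular, $\gamma_{n-1}(f(C_g))=1$ if and only if $q(t)$ is primitive.
   Context: An elementary divisor domain (EDD) is an integral domain $R$ such that for every matrix $M$ over $R$ there are unimodular (i.e. invertible over $R$) matrices $U,V$ with $UMV$ diagonal and each diagonal entry dividing the next; in particular $R$ is a GCD domain. GCDs, determinantal divisors and resultants are taken up to multiplication by units of $R$. For a monic polynomial $g(t)=t^n+\sum_{i=0}^{n-1}g_it^i\in R[t]$, the companion matrix $C_g\in R^{n\times n}$ has first row $(-g_{n-1},\dots,-g_1,-g_0)$, entries $1$ in positions $(i+1,i)$ for $1\le i\le n-1$, and $0$ elsewhere. For $f(t)=\sum_i f_it^i\in R[t]$, $f(C_g)=\sum_i f_iC_g^i$. For $M\in R^{n\times n}$, $\gamma_0(M)=1$ and, for $1\le i\le n$, the $i$-th determinantal divisor $\gamma_i(M)$ is the GCD of all minors of $M$ of order $i$. $\operatorname{Res}(f,g)=\prod_{\theta: g(\theta)=0}f(\theta)=\det f(C_g)$ (roots with multiplicity in an algebraic closure of the fraction field). Two polynomials are coprime if they have no common divisor of positive degree. The content $\operatorname{cont}(q)$ is the GCD of the coefficients of $q$ (and $\operatorname{cont}(0)=0$); $q$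 is primitive if its content is a unit. *)

theory Defs
  imports
    "HOL-Algebra.Algebraic_Closure_Type"
    "Jordan_Normal_Form.Determinant"
    "Jordan_Normal_Form.DL_Submatrix"
begin

definition smith_normal_form :: "'a::idom mat \<Rightarrow> bool" where
  "smith_normal_form D \<longleftrightarrow>
     diagonal_mat D \<and>
     (\<forall>i. Suc i < min (dim_row D) (dim_col D) \<longrightarrow> D $$ (i, i) dvd D $$ (Suc i, Suc i))"

definition elementary_divisor_domain :: "'a::idom itself \<Rightarrow> bool" where
  "elementary_divisor_domain _ \<longleftrightarrow>
     (\<forall>M :: 'a mat. \<exists>U V.
        U \<in> carrier_mat (dim_row M) (dim_row M) \<and> invertible_mat U \<and>
        V \<in> carrier_mat (dim_col M) (dim_col M) \<and> invertible_mat V \<and>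
        smith_normal_form (U * M * V))"

definition eq_up_to_unit :: "'a::idom \<Rightarrow> 'a \<Rightarrow> bool" where
  "eq_up_to_unit a b \<longleftrightarrow> (\<exists>u. u dvd 1 \<and> a = u * b)"

definition is_gcd_of :: "'a::idom \<Rightarrow> 'a set \<Rightarrow> bool" where
  "is_gcd_of d S \<longleftrightarrow> (\<forall>s\<in>S. d dvd s) \<and> (\<forall>e. (\<forall>s\<in>S. e dvd s) \<longrightarrow> e dvd d)"

text \<open>
  A type of class \<^class>\<open>idom\<close> comes with no canonical choice of a gcd, so \<open>gcd_of\<close>
  is an arbitrary representative of the class of gcds up to units; it is
  unspecified when \<open>S\<close> has no gcd.  Over an elementary divisor domain every finite
  set has one.
\<close>
definition gcd_of :: "'a::idom set \<Rightarrow> 'a" where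
  "gcd_of S = (SOME d. is_gcd_of d S)"

definition minors :: "nat \<Rightarrow> 'a::comm_ring_1 mat \<Rightarrow> 'a set" where
  "minors k M =
     {det (submatrix M I J) | I J.
        I \<subseteq> {..<dim_row M} \<and> card I = k \<and> J \<subseteq> {..<dim_col M} \<and> card J = k}"

definition det_divisor :: "nat \<Rightarrow> 'a::idom mat \<Rightarrow> 'a" where
  "det_divisor k M = (if k = 0 then 1 else gcd_of (minors k M))"

text \<open>
  The content functions of the library need a type class that fixes gcds.  The
  coefficient set of the zero polynomial is empty, and its only gcd is \<open>0\<close>.
\<close>
definition cont :: "'a::idom poly \<Rightarrow> 'a" where
  "cont q = gcd_of (set (coeffs q))"

definition primitive_poly :: "'a::idom poly \<Rightarrow> bool" where
  "primitive_poly q \<longleftrightarrow> cont q dvd 1"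

text \<open>
  This is not \<^const>\<open>coprime\<close>, which would also exclude common divisors of degree
  zero such as a common constant non-unit factor.
\<close>
definition coprime_polys :: "'a::idom poly \<Rightarrow> 'a poly \<Rightarrow> bool" where
  "coprime_polys f g \<longleftrightarrow> \<not> (\<exists>h. h dvd f \<and> h dvd g \<and> degree h > 0)"

text \<open>Row and column indices start at \<open>0\<close>.\<close>
definition companion_mat :: "'a::comm_ring_1 poly \<Rightarrow> 'a mat" where
  "companion_mat g = (let n = degree g in
     mat n n (\<lambda>(i, j). if i = 0 then - coeff g (n - 1 - j) else if i = Suc j then 1 else 0))"

text \<open>
  Matrices of all sizes share one type, which therefore has no generic zero for
  \<^const>\<open>sum\<close>; the sum \<open>\<Sum>\<^sub>k f\<^sub>k A\<^sup>k\<close> is formed entrywise.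
\<close>
definition eval_poly_mat :: "'a::comm_ring_1 poly \<Rightarrow> 'a mat \<Rightarrow> 'a mat" where
  "eval_poly_mat f A =
     mat (dim_row A) (dim_row A) (\<lambda>(i, j). \<Sum>k\<le>degree f. coeff f k * (A ^\<^sub>m k) $$ (i, j))"

definition to_closure :: "'a::idom \<Rightarrow> 'a fract alg_closure" where
  "to_closure a = to_ac (to_fract a)"

text \<open>
  The product of the values of \<open>f\<close> at the roots of \<open>g\<close>, with multiplicity,
  pulled back to the ring along the injection \<^const>\<open>to_closure\<close>.  For monic \<open>g\<close> the
  product is a symmetric function of the roots, so it lies in the range of this
  injection.  This normalisation differs from that of the Sylvester resultant by a sign
  (and, for non-monic \<open>g\<close>, by a power of the leading coefficient).
\<close>
definition Res :: "'a::idom poly \<Rightarrow> 'a poly \<Rightarrow> 'a" where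
  "Res f g = (THE r. to_closure r =
     (\<Prod>\<theta> \<in># proots (map_poly to_closure g). poly (map_poly to_closure f) \<theta>))"

end

theory Submission
  imports Defs "Jordan_Normal_Form.Char_Poly"
begin

text \<open>
  Write \<open>A = f(C\<^sub>g)\<close>.  Row \<open>i\<close> of \<open>A\<close> lists the coefficients of \<open>f t\<^bsup>n-1-i\<^esup>\<close> modulo \<open>g\<close>, so
  matrices that are polynomials in \<open>C\<^sub>g\<close> can be identified with residue classes modulo \<open>g\<close>.
  Over an algebraic closure, passing to the basis \<open>1, t - \<theta>\<^sub>0, (t - \<theta>\<^sub>0)(t - \<theta>\<^sub>1), \<dots>\<close> makes
  multiplication by \<open>f\<close> triangular, whence \<open>det A = Res(f, g)\<close>.  This determinant is nonzero:
  a kernel vector gives a nonzero \<open>h\<close> of degree less than \<open>n\<close> with \<open>g\<close> dividing \<open>f h\<close>; taking \<open>h\<close> of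
  minimal degree and primitive, Gauss' lemma gives \<open>g = h d\<close>, and then \<open>d\<close> is a common divisor of
  \<open>f\<close> and \<open>g\<close> of positive degree.  Hence \<open>f q = Res(f, g)\<close> modulo \<open>g\<close> forces \<open>q(C\<^sub>g)\<close> to be the
  adjugate of \<open>A\<close>, whose entries are up to sign the minors of order \<open>n - 1\<close>.  The last row of
  \<open>q(C\<^sub>g)\<close> lists the coefficients of \<open>q\<close> and all entries are linear combinations of these, so the
  minors and the coefficients have the same common divisors.
\<close>

section \<open>Matrices acting on residue classes modulo \<open>g\<close>\<close>

text \<open>Column \<open>j\<close> carries the exponent \<open>dim_col A - 1 - j\<close>, matching
  the descending order of the coefficients in the first row of \<open>companion_mat\<close>. The
  last column holds the constant terms.\<close>

definition row_poly :: "'a::comm_ring_1 mat \<Rightarrow> nat \<Rightarrow> 'a poly" where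
  "row_poly A i = (\<Sum>j<dim_col A. monom (A $$ (i, j)) (dim_col A - Suc j))"

text \<open>\<open>A\<close> is the matrix of multiplication by \<open>x\<close> on R[t]/(g), acting
  on row vectors in the basis t^(n-1), ..., t, 1 when \<open>g\<close> is monic. Since rows are only
  compared modulo \<open>g\<close>, \<open>x\<close> may have any degree.\<close>

definition represents :: "'a::comm_ring_1 poly \<Rightarrow> 'a mat \<Rightarrow> 'a poly \<Rightarrow> bool" where
  "represents g A x \<longleftrightarrow> A \<in> carrier_mat (degree g) (degree g) \<and>
     (\<forall>i<degree g. g dvd row_poly A i - x * monom 1 (degree g - Suc i))"

lemma smult_sum_right: "smult c (\<Sum>i\<in>I. p i) = (\<Sum>i\<in>I. smult c (p i))"
  by (induction I rule: infinite_finite_induct) (auto simp: smult_add_right)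

lemma sum_monom_coeff_rev:
  assumes "degree p < n"
  shows "(\<Sum>j<n. monom (coeff p (n - Suc j)) (n - Suc j)) = p"
proof -
  have "(\<Sum>j<n. monom (coeff p (n - Suc j)) (n - Suc j)) = (\<Sum>j<n. monom (coeff p j) j)"
    by (rule sum.nat_diff_reindex)
  also have "\<dots> = p"
    using poly_as_sum_of_monoms'[of p "n - 1"] assms
    by (cases n) (auto simp: lessThan_Suc_atMost)
  finally show ?thesis .
qed

lemma coeff_row_poly:
  assumes "j < dim_col A"
  shows "coeff (row_poly A i) (dim_col A - Suc j) = A $$ (i, j)"
proof -
  have "coeff (row_poly A i) (dim_col A - Suc j) =
      (\<Sum>k<dim_col A. if k = j then A $$ (i, k) else 0)"
    unfolding row_poly_def coeff_sum coeff_monom using assms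
    by (intro sum.cong) auto
  then show ?thesis using assms by simp
qed

lemma degree_row_poly:
  assumes "dim_col A > 0"
  shows "degree (row_poly A i) < dim_col A"
proof -
  have "degree (row_poly A i) \<le> dim_col A - 1"
    unfolding row_poly_def
    by (rule degree_sum_le) (auto intro!: order.trans[OF degree_monom_le])
  then show ?thesis using assms by simp
qed

lemma row_poly_mult:
  assumes "A \<in> carrier_mat m n" "B \<in> carrier_mat n k" "i < m"
  shows "row_poly (A * B) i = (\<Sum>l<n. smult (A $$ (i, l)) (row_poly B l))"
proof -
  have "row_poly (A * B) i = (\<Sum>j<k. \<Sum>l<n. smult (A $$ (i, l)) (monom (B $$ (l, j)) (k - Suc j)))"
    unfolding row_poly_def using assms
    by (auto simp: scalar_prod_def smult_monom monom_sum atLeast0LessThan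
        intro!: sum.cong)
  also have "\<dots> = (\<Sum>l<n. smult (A $$ (i, l)) (row_poly B l))"
    unfolding row_poly_def using assms
    by (subst sum.swap) (auto simp: smult_sum_right)
  finally show ?thesis .
qed

lemma dvd_degree_less_imp_eq:
  fixes g :: "'a::idom poly"
  assumes "g dvd p - q" "degree p < degree g" "degree q < degree g"
  shows "p = q"
  using assms degree_diff_less[of p "degree g" q] dvd_imp_degree_le[of g "p - q"] by fastforce

text \<open>A row of \<open>A * B\<close> combines the rows of \<open>B\<close> as a row of
  \<open>A\<close> combines monomials, so right multiplication by \<open>B\<close> is multiplication
  by \<open>y\<close>. \<open>A\<close> may be any matrix with n columns: the lemma serves products
  of represented matrices, a change of basis and a single kernel row.\<close>

lemma row_poly_mult_represents:
  assumes A: "A \<in> carrier_mat m (degree g)" and B: "represents g B y" and i: "i < m"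
  shows "g dvd row_poly (A * B) i - y * row_poly A i"
proof -
  let ?n = "degree g"
  have "row_poly (A * B) i - y * row_poly A i =
     (\<Sum>l<?n. smult (A $$ (i, l)) (row_poly B l - y * monom 1 (?n - Suc l)))"
  proof -
    have "row_poly A i = (\<Sum>l<?n. smult (A $$ (i, l)) (monom 1 (?n - Suc l)))"
      using A by (simp add: row_poly_def smult_monom)
    then show ?thesis
      using row_poly_mult[OF A _ i, of B ?n] B
      by (simp add: represents_def sum_distrib_left sum_subtractf smult_diff_right)
  qed
  then show ?thesis
    using B by (auto simp: represents_def intro!: dvd_sum dvd_smult)
qed

lemma represents_mult:
  assumes A: "represents g A x" and B: "represents g B y"
  shows "represents g (A * B) (y * x)"
  unfolding represents_def
proof (intro conjI allI impI)
  show "A * B \<in> carrier_mat (degree g) (degree g)"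
    using A B by (auto simp: represents_def)
  fix i assume i: "i < degree g"
  let ?t = "monom 1 (degree g - Suc i)"
  have "g dvd (row_poly (A * B) i - y * row_poly A i) + y * (row_poly A i - x * ?t)"
    using A i by (intro dvd_add row_poly_mult_represents[OF _ B] dvd_mult) (auto simp: represents_def)
  then show "g dvd row_poly (A * B) i - (y * x) * ?t"
    by (simp add: algebra_simps)
qed

lemma row_poly_eq_imp_eq:
  assumes "A \<in> carrier_mat m n" "B \<in> carrier_mat m n" "\<And>i. i < m \<Longrightarrow> row_poly A i = row_poly B i"
  shows "A = B"
proof (rule eq_matI)
  fix i j assume "i < dim_row B" "j < dim_col B"
  then show "A $$ (i, j) = B $$ (i, j)"
    using assms coeff_row_poly[of j A i] coeff_row_poly[of j B i] by simp
qed (use assms in auto)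

text \<open>Congruent row polynomials of degree below \<open>degree g\<close> coincide, so
  identities between matrices follow from congruences modulo \<open>g\<close>.\<close>

lemma represents_unique:
  fixes g :: "'a::idom poly"
  assumes A: "represents g A x" and B: "represents g B y" and "g dvd x - y" "degree g > 0"
  shows "A = B"
proof (rule row_poly_eq_imp_eq)
  fix i assume i: "i < degree g"
  let ?t = "monom 1 (degree g - Suc i)"
  have "g dvd row_poly A i - x * ?t" "g dvd row_poly B i - y * ?t" "g dvd (x - y) * ?t"
    using A B i assms(3) by (auto simp: represents_def)
  then have "g dvd (row_poly A i - x * ?t) - (row_poly B i - y * ?t) + (x - y) * ?t"
    by (rule dvd_add[OF dvd_diff])
  then have "g dvd row_poly A i - row_poly B i"
    by (simp add: algebra_simps)
  then show "row_poly A i = row_poly B i"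
    using degree_row_poly[of A i] degree_row_poly[of B i] A B assms
    by (intro dvd_degree_less_imp_eq) (auto simp: represents_def)
qed (use A B in \<open>auto simp: represents_def\<close>)

lemma represents_one:
  fixes g :: "'a::comm_ring_1 poly"
  shows "represents g (1\<^sub>m (degree g)) 1"
proof -
  have "row_poly (1\<^sub>m (degree g)) i = (monom 1 (degree g - Suc i) :: 'a poly)" if "i < degree g" for i
  proof -
    have "row_poly (1\<^sub>m (degree g)) i =
        (\<Sum>j<degree g. if j = i then monom (1 :: 'a) (degree g - Suc j) else 0)"
      unfolding row_poly_def using that by (intro sum.cong) auto
    then show ?thesis using that by simp
  qed
  then show ?thesis by (simp add: represents_def)
qed

lemma represents_smult_one: "represents g (c \<cdot>\<^sub>m 1\<^sub>m (degree g)) [:c:]"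
proof -
  have "row_poly (c \<cdot>\<^sub>m 1\<^sub>m (degree g)) i = smult c (row_poly (1\<^sub>m (degree g)) i)"
    if "i < degree g" for i
    using that by (auto simp: row_poly_def smult_sum_right smult_monom intro!: sum.cong)
  then have "row_poly (c \<cdot>\<^sub>m 1\<^sub>m (degree g)) i - [:c:] * monom 1 (degree g - Suc i) =
      smult c (row_poly (1\<^sub>m (degree g)) i - 1 * monom 1 (degree g - Suc i))"
    if "i < degree g" for i
    using that by (simp add: smult_diff_right)
  then show ?thesis
    using represents_one[of g] by (auto simp: represents_def intro: dvd_smult)
qed

text \<open>Multiplication by t shifts each basis monomial to the next higher power, which gives the
  subdiagonal ones. Only t^(n-1) overflows, and t^n is congruent to t^n - g, whose coefficients fill
  row 0.\<close>

lemma represents_companion_mat: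
  fixes g :: "'a::comm_ring_1 poly"
  assumes "lead_coeff g = 1"
  shows "represents g (companion_mat g) (monom 1 1)"
  unfolding represents_def
proof (intro conjI allI impI)
  let ?n = "degree g"
  show "companion_mat g \<in> carrier_mat ?n ?n"
    by (simp add: companion_mat_def Let_def)
  fix i assume i: "i < ?n"
  have dim: "dim_col (companion_mat g) = ?n"
    by (simp add: companion_mat_def Let_def)
  show "g dvd row_poly (companion_mat g) i - monom 1 1 * monom 1 (?n - Suc i)"
  proof (cases i)
    case 0
    have "row_poly (companion_mat g) 0 = - (\<Sum>j<?n. monom (coeff g (?n - Suc j)) (?n - Suc j))"
      unfolding row_poly_def dim sum_negf[symmetric] using i
      by (intro sum.cong) (auto simp: companion_mat_def Let_def minus_monom)
    also have "\<dots> = - (\<Sum>j<?n. monom (coeff g j) j)"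
      by (subst sum.nat_diff_reindex) simp
    also have "\<dots> = monom 1 ?n - g"
      using poly_as_sum_of_monoms[of g] assms by (simp add: lessThan_Suc_atMost[symmetric] algebra_simps)
    finally show ?thesis using 0 i by (simp add: mult_monom)
  next
    case (Suc k)
    have "row_poly (companion_mat g) i = (\<Sum>j<?n. if j = k then monom 1 (?n - Suc j) else 0)"
      unfolding row_poly_def dim using i Suc
      by (intro sum.cong) (auto simp: companion_mat_def Let_def)
    also have "\<dots> = monom 1 (?n - i)"
      using i Suc by simp
    finally show ?thesis using i by (simp add: mult_monom Suc_diff_Suc)
  qed
qed

lemma represents_pow_mat:
  assumes "represents g A x"
  shows "represents g (A ^\<^sub>m k) (x ^ k)"
proof (induction k)
  case 0
  then show ?case using represents_one[of g] assms by (auto simp: represents_def)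
next
  case (Suc k)
  then show ?case using represents_mult[OF Suc assms] by simp
qed

lemma represents_eval_poly_mat:
  fixes g :: "'a::comm_ring_1 poly"
  assumes "lead_coeff g = 1"
  shows "represents g (eval_poly_mat f (companion_mat g)) f"
  unfolding represents_def
proof (intro conjI allI impI)
  let ?n = "degree g" and ?C = "companion_mat g"
  have dim: "dim_row ?C = ?n"
    by (simp add: companion_mat_def Let_def)
  show A: "eval_poly_mat f ?C \<in> carrier_mat ?n ?n"
    by (simp add: eval_poly_mat_def dim)
  fix i assume i: "i < ?n"
  let ?t = "monom 1 (?n - Suc i)"
  have pow: "represents g (?C ^\<^sub>m k) (monom 1 k)" for k
    using represents_pow_mat[OF represents_companion_mat[OF assms], of k]
    by (simp add: monom_power)
  then have dimp: "dim_col (?C ^\<^sub>m k) = ?n" for k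
    unfolding represents_def by (meson carrier_matD(2))
  have "row_poly (eval_poly_mat f ?C) i = (\<Sum>j<?n. \<Sum>k\<le>degree f.
      smult (coeff f k) (monom ((?C ^\<^sub>m k) $$ (i, j)) (?n - Suc j)))"
    using A i by (auto simp: row_poly_def eval_poly_mat_def dim smult_monom
        monom_sum intro!: sum.cong)
  also have "\<dots> = (\<Sum>k\<le>degree f. smult (coeff f k) (row_poly (?C ^\<^sub>m k) i))"
    unfolding row_poly_def dimp smult_sum_right by (rule sum.swap)
  finally have "row_poly (eval_poly_mat f ?C) i - f * ?t =
     (\<Sum>k\<le>degree f. smult (coeff f k) (row_poly (?C ^\<^sub>m k) i)) -
     (\<Sum>k\<le>degree f. monom (coeff f k) k) * ?t"
    by (simp add: poly_as_sum_of_monoms)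
  also have "\<dots> = (\<Sum>k\<le>degree f. smult (coeff f k) (row_poly (?C ^\<^sub>m k) i - monom 1 k * ?t))"
    by (simp add: sum_distrib_right sum_subtractf smult_diff_right mult_monom smult_monom)
  finally show "g dvd row_poly (eval_poly_mat f ?C) i - f * ?t"
    using pow i by (auto simp: represents_def intro!: dvd_sum dvd_smult)
qed

section \<open>Gauss' lemma and annihilators of \<open>f\<close> modulo \<open>g\<close>\<close>

text \<open>
  Gauss' lemma, proved as in McCoy's theorem on zero divisors: modulo \<open>a\<close>, if \<open>h s = 0\<close> then the
  top coefficient of each \<open>h\<^sub>i s\<close> vanishes, so an induction on the degree of \<open>s\<close> applies to
  \<open>h\<^sub>i s\<close>.
\<close>
lemma dvd_coeff_of_dvd_coeff_mult:
  fixes h s :: "'a::idom poly"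
  assumes unit: "(\<Sum>i\<le>degree h. c i * coeff h i) = 1"
    and "\<And>i. a dvd coeff (h * s) i"
  shows "a dvd coeff s j"
proof -
  have "(\<forall>j. a dvd coeff s j)"
    if "\<forall>i\<ge>N. a dvd coeff s i" "\<forall>i. a dvd coeff (h * s) i" for N s
    using that
  proof (induction N arbitrary: s)
    case 0
    then show ?case by simp
  next
    case (Suc N)
    have scaled: "\<forall>j. a dvd coeff h i * coeff s j" for i
    proof (induction "degree h - i" arbitrary: i rule: less_induct)
      case less
      have above: "a dvd coeff h l * coeff s j" if "l > i" for l j
        using less[of l] that coeff_eq_0[of h l] by (cases "l \<le> degree h") auto
      \<comment> \<open>This is coefficient \<open>i + N\<close> of \<open>h * s\<close>. Modulo
        \<open>a\<close> only \<open>coeff h i * coeff s N\<close> survives: the terms with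
        \<open>l > i\<close> vanish by \<open>above\<close>, those with \<open>l < i\<close> involve
        coefficients of \<open>s\<close> of index greater than \<open>N\<close>.\<close>
      have "a dvd (\<Sum>l\<le>i + N. coeff h l * coeff s (i + N - l))"
        using Suc.prems by (simp add: coeff_mult)
      also have "(\<Sum>l\<le>i + N. coeff h l * coeff s (i + N - l)) =
          coeff h i * coeff s N + (\<Sum>l\<in>{..i + N} - {i}. coeff h l * coeff s (i + N - l))"
        by (subst sum.remove[of _ i]) auto
      finally have "a dvd coeff h i * coeff s N +
          (\<Sum>l\<in>{..i + N} - {i}. coeff h l * coeff s (i + N - l))" .
      moreover have "a dvd (\<Sum>l\<in>{..i + N} - {i}. coeff h l * coeff s (i + N - l))"
      proof (rule dvd_sum)
        fix l assume l: "l \<in> {..i + N} - {i}"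
        show "a dvd coeff h l * coeff s (i + N - l)"
        proof (cases "l > i")
          case False
          then show ?thesis using l Suc.prems by (intro dvd_mult) auto
        qed (use above in auto)
      qed
      ultimately have "a dvd coeff h i * coeff s N"
        by (simp add: dvd_add_left_iff)
      then have "a dvd coeff (smult (coeff h i) s) j" if "j \<ge> N" for j
        using Suc.prems that by (cases "j = N") auto
      moreover have "\<forall>j. a dvd coeff (h * smult (coeff h i) s) j"
        using Suc.prems by auto
      ultimately show ?case
        using Suc.IH[of "smult (coeff h i) s"] by (metis coeff_smult)
    qed
    show ?case
    proof
      fix j
      have "a dvd (\<Sum>i\<le>degree h. c i * (coeff h i * coeff s j))"
        using scaled by (auto intro!: dvd_sum)
      also have "\<dots> = (\<Sum>i\<le>degree h. c i * coeff h i) * coeff s j"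
        by (simp add: sum_distrib_right mult.assoc)
      finally show "a dvd coeff s j" by (simp add: unit)
    qed
  qed
  from this[of "Suc (degree s)" s] show ?thesis
    using assms by (auto simp: Suc_le_eq coeff_eq_0)
qed

text \<open>The Smith form \<open>W\<close> of the one-row matrix of the \<open>a i\<close> has
  \<open>d\<close> as its only possibly nonzero entry. Reading W = U M V gives \<open>d\<close> as a
  combination of the \<open>a i\<close>; reading M = U' W V' shows that \<open>d\<close> divides
  each of them.\<close>

lemma elementary_divisor_domain_bezout:
  fixes a :: "nat \<Rightarrow> 'a::idom"
  assumes "elementary_divisor_domain TYPE('a)"
  shows "\<exists>d c. (\<forall>i<m. d dvd a i) \<and> d = (\<Sum>i<m. c i * a i)"
proof (cases "m = 0")
  case False
  define M where "M = mat 1 m (\<lambda>(i, j). a j)"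
  have M: "M \<in> carrier_mat 1 m" by (simp add: M_def)
  obtain U V where U: "U \<in> carrier_mat 1 1" "invertible_mat U"
    and V: "V \<in> carrier_mat m m" "invertible_mat V" and D: "smith_normal_form (U * M * V)"
    using assms M unfolding elementary_divisor_domain_def by (metis carrier_matD)
  obtain U' where U': "U' * U = 1\<^sub>m 1" "U' \<in> carrier_mat 1 1"
    using U unfolding invertible_mat_def inverts_mat_def
    by (metis carrier_matD carrier_matI index_mult_mat(2,3) index_one_mat(2,3))
  obtain V' where V': "V * V' = 1\<^sub>m m" "V' \<in> carrier_mat m m"
    using V unfolding invertible_mat_def inverts_mat_def
    by (metis carrier_matD carrier_matI index_mult_mat(2,3) index_one_mat(2,3))
  define W where "W = U * M * V"
  have W: "W \<in> carrier_mat 1 m" using U M V by (simp add: W_def)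
  define d where "d = W $$ (0, 0)"
  have D0: "W $$ (0, j) = 0" if "j < m" "j \<noteq> 0" for j
    using D that carrier_matD[OF W]
    unfolding smith_normal_form_def diagonal_mat_def W_def[symmetric] by simp
  have MV: "M * V \<in> carrier_mat 1 m" using M V by simp
  have "U' * W = U' * (U * (M * V))"
    by (simp only: W_def assoc_mult_mat[OF U(1) M V(1)])
  also have "\<dots> = (U' * U) * (M * V)"
    by (rule assoc_mult_mat[OF U'(2) U(1) MV, symmetric])
  also have "\<dots> = M * V"
    by (simp only: U'(1) left_mult_one_mat[OF MV])
  finally have "U' * W * V' = M * (V * V')"
    by (simp only: assoc_mult_mat[OF M V(1) V'(2)])
  then have eq: "U' * W * V' = M"
    by (simp only: V'(1) right_mult_one_mat[OF M])
  have "d dvd a j" if "j < m" for j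
  proof -
    have "a j = (U' * W * V') $$ (0, j)"
      using that by (simp only: eq) (simp add: M_def)
    also have "\<dots> = (\<Sum>k<m. U' $$ (0, 0) * W $$ (0, k) * V' $$ (k, j))"
      using U' W V' that by (simp add: scalar_prod_def atLeast0LessThan sum_distrib_left mult.assoc)
    also have "d dvd \<dots>"
    proof (rule dvd_sum)
      fix k assume "k \<in> {..<m}"
      then show "d dvd U' $$ (0, 0) * W $$ (0, k) * V' $$ (k, j)"
        using D0 by (cases "k = 0") (auto simp: d_def)
    qed
    finally show ?thesis .
  qed
  moreover have "d = (\<Sum>i<m. (U $$ (0, 0) * V $$ (i, 0)) * a i)"
  proof -
    have "d = (\<Sum>i<m. U $$ (0, 0) * M $$ (0, i) * V $$ (i, 0))"
      using U M V False unfolding d_def W_def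
      by (simp add: scalar_prod_def atLeast0LessThan sum_distrib_left mult.assoc)
    then show ?thesis by (simp add: M_def mult_ac)
  qed
  ultimately show ?thesis
    by (intro exI[of _ d] exI[of _ "\<lambda>i. U $$ (0, 0) * V $$ (i, 0)"]) auto
qed simp

text \<open>Dividing by the gcd of the coefficients and cancelling it in its Bezout identity leaves
  a Bezout identity for \<open>h\<close>, the form of primitivity that the Gauss lemma above takes
  as hypothesis.\<close>

lemma primitive_factor:
  fixes p :: "'a::idom poly"
  assumes "elementary_divisor_domain TYPE('a)" "p \<noteq> 0"
  obtains d h c where "d \<noteq> 0" "p = smult d h" "(\<Sum>i\<le>degree h. c i * coeff h i) = 1"
proof -
  obtain d c where d: "\<forall>i<Suc (degree p). d dvd coeff p i"
      "d = (\<Sum>i<Suc (degree p). c i * coeff p i)"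
    using elementary_divisor_domain_bezout[OF assms(1)] by blast
  have "d dvd coeff p i" for i
    using d by (cases "i \<le> degree p") (auto simp: coeff_eq_0)
  then obtain h where h: "p = smult d h"
    using const_poly_dvd_iff[of d p] by (auto elim!: dvdE)
  with assms have d0: "d \<noteq> 0" by auto
  have "d * 1 = d * (\<Sum>i\<le>degree h. c i * coeff h i)"
    using d(2) d0 by (simp add: h lessThan_Suc_atMost sum_distrib_left mult_ac)
  with d0 have "(\<Sum>i\<le>degree h. c i * coeff h i) = 1"
    by (metis mult_left_cancel)
  with d0 h that show thesis by blast
qed

text \<open>The leading coefficient alone supplies the Bezout identity for a monic \<open>g\<close>,
  so Gauss' lemma removes the constant \<open>d\<close> from the cofactor.\<close>

lemma monic_dvd_smult_cancel:
  fixes g p :: "'a::idom poly"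
  assumes "lead_coeff g = 1" "g dvd smult d p" "d \<noteq> 0"
  shows "g dvd p"
proof -
  obtain k where k: "smult d p = g * k" using assms(2) by (rule dvdE)
  have "d dvd coeff k j" for j
  proof (rule dvd_coeff_of_dvd_coeff_mult)
    show "(\<Sum>i\<le>degree g. (if i = degree g then 1 else 0) * coeff g i) = 1"
      using assms by (simp add: if_distrib if_distribR cong: if_cong)
    show "d dvd coeff (g * k) i" for i
      using k[symmetric] by simp
  qed
  then obtain k' where "k = smult d k'"
    using const_poly_dvd_iff[of d k] by (auto elim!: dvdE)
  with k assms have "p = g * k'"
    by (metis mult_smult_right smult_cancel)
  then show ?thesis by simp
qed

text \<open>For coprime \<open>f\<close> and \<open>g\<close> this makes \<open>f\<close> a
  non-zero-divisor modulo \<open>g\<close>, which yields both the nonvanishing of the determinant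
  and the uniqueness of \<open>q\<close>.\<close>

lemma common_divisor_of_annihilator:
  fixes f g :: "'a::idom poly"
  assumes edd: "elementary_divisor_domain TYPE('a)" and monic: "lead_coeff g = 1"
    and "h0 \<noteq> 0" "degree h0 < degree g" "g dvd f * h0"
  shows "\<not> coprime_polys f g"
proof -
  let ?P = "\<lambda>h. h \<noteq> 0 \<and> g dvd f * h"
  obtain h1 where h1: "?P h1" and h1_min: "\<And>h. ?P h \<Longrightarrow> degree h1 \<le> degree h"
    using ex_has_least_nat[of ?P h0 degree] assms by blast
  obtain d h c where d: "d \<noteq> 0" "h1 = smult d h" and c: "(\<Sum>i\<le>degree h. c i * coeff h i) = 1"
    using primitive_factor[OF edd, of h1] h1 by blast
  have h: "h \<noteq> 0" "g dvd f * h"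
    using h1 d monic_dvd_smult_cancel[OF monic, of d "f * h"] by auto
  have h_min: "degree h \<le> degree p" if "?P p" for p
    using h1_min[OF that] d by simp
  \<comment> \<open>Pseudo-division replaces division with remainder by the possibly non-monic
    \<open>h\<close>. The pseudo-remainder is again annihilated by \<open>f\<close> modulo
    \<open>g\<close>, and its degree would contradict the minimality of \<open>h\<close> unless it
    is zero.\<close>
  obtain a q where aq: "a \<noteq> 0" "smult a g = h * q + pseudo_mod g h"
    using pseudo_mod(1)[OF h(1)] by blast
  have "g dvd smult a (f * g) - (f * h) * q"
    using h by (intro dvd_diff dvd_smult) auto
  also have "smult a (f * g) - (f * h) * q = f * (smult a g - h * q)"
    by (simp add: algebra_simps)
  also have "\<dots> = f * pseudo_mod g h"
    using aq by simp
  finally have "pseudo_mod g h = 0"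
    using h_min[of "pseudo_mod g h"] pseudo_mod(2)[OF h(1), of g] by force
  then have hq: "smult a g = h * q" using aq by simp
  have "a dvd coeff q j" for j
    using dvd_coeff_of_dvd_coeff_mult[OF c, of a q] hq[symmetric] by simp
  then obtain k where "q = smult a k"
    using const_poly_dvd_iff[of a q] by (auto elim!: dvdE)
  with hq aq have g: "g = h * k" by (metis mult_smult_right smult_cancel)
  \<comment> \<open>The cofactor of \<open>h\<close> in \<open>g\<close> is the common divisor:
    \<open>h\<close> cancels from the divisibility of \<open>f * h\<close> by
    \<open>g = h * k\<close>.\<close>
  then have "h * k dvd h * f" using h by (simp add: mult.commute)
  then have "k dvd f" using h by simp
  moreover have "degree h < degree g"
    using h_min[of h0] assms by simp
  moreover have "degree g = degree h + degree k"
    using g monic h(1) by (cases "k = 0") (auto simp: degree_mult_eq)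
  ultimately have "degree k > 0" by simp
  moreover note \<open>k dvd f\<close>
  ultimately show ?thesis
    unfolding coprime_polys_def g by (metis dvd_triv_right)
qed

section \<open>The resultant as a determinant\<close>

text \<open>Downward induction on \<open>k\<close>: in f = (t - \<theta>_k) f' + f(\<theta>_k), the
  first summand turns \<open>p k\<close> into \<open>p (Suc k)\<close>, to which the induction
  hypothesis for f' applies, and the second contributes the diagonal coefficient. At
  \<open>k = n\<close> the sum is empty.\<close>

lemma newton_expansion:
  fixes f :: "'a::comm_ring_1 poly" and \<theta> :: "nat \<Rightarrow> 'a"
  defines "p \<equiv> \<lambda>k. \<Prod>j<k. [:- \<theta> j, 1:]"
  assumes "k \<le> n"
  shows "\<exists>c. p n dvd f * p k - (\<Sum>l\<in>{k..<n}. smult (c l) (p l)) \<and> (k < n \<longrightarrow> c k = poly f (\<theta> k))"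
  using assms(2)
proof (induction arbitrary: f rule: inc_induct)
  case base
  then show ?case by simp
next
  case (step k)
  let ?f' = "synthetic_div f (\<theta> k)"
  obtain c where c: "p n dvd ?f' * p (Suc k) - (\<Sum>l\<in>{Suc k..<n}. smult (c l) (p l))"
    using step.IH by blast
  let ?c = "c(k := poly f (\<theta> k))"
  have "f * p k = ([:- \<theta> k, 1:] * ?f' + [:poly f (\<theta> k):]) * p k"
    by (simp only: synthetic_div_correct')
  also have "\<dots> = ?f' * p (Suc k) + smult (poly f (\<theta> k)) (p k)"
    by (simp add: p_def algebra_simps)
  finally have "f * p k = ?f' * p (Suc k) + smult (poly f (\<theta> k)) (p k)" .
  moreover have "(\<Sum>l\<in>{k..<n}. smult (?c l) (p l)) =
      smult (poly f (\<theta> k)) (p k) + (\<Sum>l\<in>{Suc k..<n}. smult (c l) (p l))"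
    using step.hyps by (subst sum.atLeast_Suc_lessThan) (auto intro!: sum.cong)
  ultimately have "f * p k - (\<Sum>l\<in>{k..<n}. smult (?c l) (p l)) =
      ?f' * p (Suc k) - (\<Sum>l\<in>{Suc k..<n}. smult (c l) (p l))"
    by simp
  with c show ?case by (intro exI[of _ ?c]) simp
qed

text \<open>\<open>P\<close> changes from monomials to the Newton basis \<open>p k\<close>, and
  \<open>T\<close> is multiplication by \<open>f\<close> in that basis. Both are triangular,
  \<open>P\<close> with unit diagonal and \<open>T\<close> with the values of \<open>f\<close> at
  the roots, so \<open>P * A = T * P\<close> gives the determinant.\<close>

lemma det_represents_split:
  fixes g :: "'a::idom poly" and \<theta> :: "nat \<Rightarrow> 'a"
  assumes g: "g = (\<Prod>j<n. [:- \<theta> j, 1:])" and A: "represents g A f" and n: "n > 0"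
  shows "det A = (\<Prod>j<n. poly f (\<theta> j))"
proof -
  define p where "p k = (\<Prod>j<k. [:- \<theta> j, 1:])" for k
  have deg: "degree (p k) = k" for k
    unfolding p_def by (subst degree_prod_eq_sum_degree) auto
  have lc: "lead_coeff (p k) = 1" for k
    unfolding p_def by (simp add: lead_coeff_prod)
  have gp: "g = p n" by (simp add: g p_def)
  have Ac: "A \<in> carrier_mat n n" using A by (simp add: represents_def gp deg)
  have "\<exists>c. p n dvd f * p k - (\<Sum>l\<in>{k..<n}. smult (c l) (p l)) \<and>
      c k = poly f (\<theta> k)" if "k < n" for k
    using newton_expansion[of k n \<theta> f] that unfolding p_def by auto
  then obtain c where c: "\<And>k. k < n \<Longrightarrow> p n dvd f * p k - (\<Sum>l\<in>{k..<n}. smult (c k l) (p l))"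
    and ck: "\<And>k. k < n \<Longrightarrow> c k k = poly f (\<theta> k)"
    by metis
  define P where "P = mat n n (\<lambda>(i, j). coeff (p (n - Suc i)) (n - Suc j))"
  \<comment> \<open>The numbers \<open>c k l\<close> are only controlled for \<open>l\<close> at
    least \<open>k\<close>, hence the cut-off. As the indices are reversed, \<open>T\<close> is
    lower triangular.\<close>
  define T where "T = mat n n (\<lambda>(i, l).
    if n - Suc i \<le> n - Suc l then c (n - Suc i) (n - Suc l) else 0)"
  have Pc: "P \<in> carrier_mat n n" and Tc: "T \<in> carrier_mat n n" by (auto simp: P_def T_def)
  have rowP: "row_poly P i = p (n - Suc i)" if "i < n" for i
  proof -
    have "row_poly P i = (\<Sum>j<n. monom (coeff (p (n - Suc i)) (n - Suc j)) (n - Suc j))"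
      using that by (simp add: row_poly_def P_def)
    also have "\<dots> = p (n - Suc i)"
      using that by (intro sum_monom_coeff_rev) (simp add: deg)
    finally show ?thesis .
  qed
  have "upper_triangular P"
    by (rule upper_triangularI) (auto simp: P_def deg intro!: coeff_eq_0)
  then have "det P = (\<Prod>i<n. P $$ (i, i))"
    using det_upper_triangular[OF _ Pc] Pc by (simp add: prod_list_diag_prod atLeast0LessThan)
  also have "\<dots> = 1"
    using lc by (intro prod.neutral) (simp add: P_def deg)
  finally have detP: "det P = 1" .
  have "T $$ (i, j) = 0" if "i < j" "j < n" for i j
    using that by (auto simp: T_def)
  then have "det T = (\<Prod>i<n. T $$ (i, i))"
    using det_lower_triangular[OF _ Tc] Tc by (simp add: prod_list_diag_prod atLeast0LessThan)
  also have "\<dots> = (\<Prod>i<n. poly f (\<theta> (n - Suc i)))"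
    by (intro prod.cong) (auto simp: T_def ck)
  also have "\<dots> = (\<Prod>j<n. poly f (\<theta> j))"
    by (rule prod.nat_diff_reindex)
  finally have detT: "det T = (\<Prod>j<n. poly f (\<theta> j))" .
  have "P * A = T * P"
  proof (rule row_poly_eq_imp_eq)
    show PA: "P * A \<in> carrier_mat n n" and TP: "T * P \<in> carrier_mat n n"
      using Pc Ac Tc by auto
    fix i assume i: "i < n"
    let ?k = "n - Suc i"
    have "row_poly (T * P) i = (\<Sum>l<n. smult (T $$ (i, l)) (p (n - Suc l)))"
      by (simp add: row_poly_mult[OF Tc Pc i] rowP)
    also have "\<dots> = (\<Sum>l<n. smult (if ?k \<le> n - Suc l then c ?k (n - Suc l) else 0) (p (n - Suc l)))"
      using i by (intro sum.cong) (auto simp: T_def)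
    also have "\<dots> = (\<Sum>l<n. smult (if ?k \<le> l then c ?k l else 0) (p l))"
      by (rule sum.nat_diff_reindex)
    also have "\<dots> = (\<Sum>l\<in>{?k..<n}. smult (c ?k l) (p l))"
      by (rule sum.mono_neutral_cong_right) auto
    finally have rowTP: "row_poly (T * P) i = (\<Sum>l\<in>{?k..<n}. smult (c ?k l) (p l))" .
    \<comment> \<open>Both rows are congruent to \<open>f * p ?k\<close>, and both have degree below
      \<open>n\<close>.\<close>
    have "g dvd (row_poly (P * A) i - f * p ?k) + (f * p ?k - row_poly (T * P) i)"
    proof (rule dvd_add)
      show "g dvd row_poly (P * A) i - f * p ?k"
        using row_poly_mult_represents[OF _ A i, of P] Pc rowP[OF i] by (simp add: gp deg)
      show "g dvd f * p ?k - row_poly (T * P) i"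
        unfolding rowTP gp using i by (intro c) simp
    qed
    then have "g dvd row_poly (P * A) i - row_poly (T * P) i" by simp
    then show "row_poly (P * A) i = row_poly (T * P) i"
      using degree_row_poly[of "P * A" i] degree_row_poly[of "T * P" i] PA TP n
      by (intro dvd_degree_less_imp_eq) (auto simp: gp deg)
  qed
  then have "det P * det A = det T * det P"
    using det_mult[OF Pc Ac] det_mult[OF Tc Pc] by metis
  then show ?thesis by (simp add: detP detT)
qed

lemma inj_idom_hom_to_closure: "inj_idom_hom (to_closure :: 'a::idom \<Rightarrow> _)"
  by unfold_locales (auto simp: to_closure_def)

lemma represents_map_to_closure:
  assumes "represents g A x"
  shows "represents (map_poly to_closure g) (map_mat to_closure A) (map_poly to_closure x)"
proof -
  interpret inj_idom_hom to_closure by (rule inj_idom_hom_to_closure)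
  interpret mp: map_poly_inj_idom_hom to_closure ..
  let ?h = "map_poly to_closure"
  have A: "A \<in> carrier_mat (degree g) (degree g)"
    using assms by (simp add: represents_def)
  have "row_poly (map_mat to_closure A) i - ?h x * monom 1 (degree g - Suc i) =
      ?h (row_poly A i - x * monom 1 (degree g - Suc i))" if "i < degree g" for i
    using A that by (simp add: row_poly_def mp.hom_minus mp.hom_mult mp.hom_sum)
  moreover have "?h g dvd ?h p" if "g dvd p" for p
    using that by (auto elim!: dvdE simp: mp.hom_mult)
  ultimately show ?thesis
    using assms by (auto simp: represents_def)
qed

lemma proots_prod_linear:
  fixes R :: "'a::idom multiset"
  shows "proots (\<Prod>x\<in>#R. [:-x, 1:]) = R"
proof (induction R)
  case (add x R)
  have "(\<Prod>x\<in>#R. [:-x, 1:]) \<noteq> 0"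
    by (auto simp: prod_mset_zero_iff)
  with add show ?case by (simp add: proots_mult del: mult_pCons_left)
qed simp

lemma prod_mset_mset_nth:
  "(\<Prod>x\<in>#mset xs. u x) = (\<Prod>j<length xs. u (xs ! j) :: 'a::comm_monoid_mult)"
  by (simp add: prod_mset_prod_list prod.list_conv_set_nth atLeast0LessThan flip: mset_map)

text \<open>The determinant commutes with the embedding into the closure, where \<open>g\<close>
  splits. So \<open>det A\<close> is a preimage of the product over the roots, and injectivity of
  \<open>to_closure\<close> makes it the one selected by \<open>THE\<close>.\<close>

lemma Res_eq_det:
  fixes f g :: "'a::idom poly"
  assumes monic: "lead_coeff g = 1" and n: "degree g > 0" and A: "represents g A f"
  shows "Res f g = det A"
proof -
  interpret inj_idom_hom "to_closure :: 'a \<Rightarrow> _" by (rule inj_idom_hom_to_closure)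
  let ?h = "map_poly (to_closure :: 'a \<Rightarrow> _)"
  have lc: "lead_coeff (?h g) = 1" using monic by simp
  then have "?h g \<noteq> 0" by force
  then obtain R where R: "size R = degree (?h g)" "?h g = (\<Prod>x\<in>#R. [:-x, 1:])"
    using alg_closed_imp_factorization[of "?h g"] lc by (metis smult_1_left)
  obtain xs where xs: "R = mset xs" by (metis ex_mset)
  have roots: "proots (?h g) = R"
    by (simp add: R(2) proots_prod_linear)
  have "to_closure (det A) = det (map_mat to_closure A)"
    by (simp add: hom_det)
  also have "\<dots> = (\<Prod>j<length xs. poly (?h f) (xs ! j))"
  proof (rule det_represents_split)
    show "?h g = (\<Prod>j<length xs. [:- (xs ! j), 1:])"
      unfolding R(2) xs by (rule prod_mset_mset_nth)
    show "represents (?h g) (map_mat to_closure A) (?h f)"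
      by (rule represents_map_to_closure[OF A])
    show "length xs > 0"
      using R(1) n by (simp add: xs)
  qed
  also have "\<dots> = (\<Prod>\<theta>\<in>#proots (?h g). poly (?h f) \<theta>)"
    unfolding roots xs by (rule prod_mset_mset_nth[symmetric])
  finally have eq: "to_closure (det A) = (\<Prod>\<theta>\<in>#proots (?h g). poly (?h f) \<theta>)" .
  show ?thesis
    unfolding Res_def eq[symmetric] by (rule the_equality) (auto simp: to_closure_def)
qed

section \<open>Minors of order n - 1 and the adjugate\<close>

text \<open>An element of a set is picked at the position given by the number of smaller elements.
  This reconciles \<open>submatrix\<close>, indexed through \<open>pick\<close>, with the index
  shift in \<open>mat_delete\<close>.\<close>

lemma pick_remove_one:
  assumes "i < n" "k < n - 1"
  shows "pick ({..<n} - {i}) k = (if k < i then k else Suc k)"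
proof -
  let ?r = "if k < i then k else Suc k"
  have "{a \<in> {..<n} - {i}. a < ?r} = (if k < i then {..<k} else {..<Suc k} - {i})"
    using assms by auto
  then have "card {a \<in> {..<n} - {i}. a < ?r} = k"
    by simp
  moreover have "?r \<in> {..<n} - {i}"
    using assms by auto
  ultimately show ?thesis
    using pick_card_in_set[of ?r "{..<n} - {i}"] by simp
qed

lemma submatrix_remove_one:
  assumes A: "A \<in> carrier_mat n n" and "i < n" "j < n"
  shows "submatrix A ({..<n} - {i}) ({..<n} - {j}) = mat_delete A i j"
proof -
  have "{a. a < n \<and> a \<in> {..<n} - {i}} = {..<n} - {i}" for i
    by auto
  then have "card {a. a < n \<and> a \<in> {..<n} - {i}} = n - 1" if "i < n" for i
    using that by simp
  then show ?thesis
    using assms by (auto simp: submatrix_def mat_delete_def pick_remove_one intro!: eq_matI)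
qed

lemma minors_pred:
  assumes A: "A \<in> carrier_mat n n" and n: "n > 0"
  shows "minors (n - 1) A = {det (mat_delete A i j) | i j. i < n \<and> j < n}"
proof -
  have co: "I \<subseteq> {..<n} \<and> card I = n - 1 \<longleftrightarrow> (\<exists>i<n. I = {..<n} - {i})" for I
  proof
    assume I: "I \<subseteq> {..<n} \<and> card I = n - 1"
    then have "finite I" by (auto intro: finite_subset)
    with I have "card ({..<n} - I) = 1"
      using n by (simp add: card_Diff_subset)
    then obtain i where "{..<n} - I = {i}" by (auto simp: card_1_singleton_iff)
    with I show "\<exists>i<n. I = {..<n} - {i}"
      by (intro exI[of _ i]) blast
  qed auto
  have "minors (n - 1) A = {det (submatrix A ({..<n} - {i}) ({..<n} - {j})) | i j. i < n \<and> j < n}"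
  proof -
    have "minors (n - 1) A = {det (submatrix A I J) | I J.
        (I \<subseteq> {..<n} \<and> card I = n - 1) \<and> (J \<subseteq> {..<n} \<and> card J = n - 1)}"
      using A by (simp add: minors_def conj_assoc)
    then show ?thesis unfolding co by blast
  qed
  also have "\<dots> = {det (mat_delete A i j) | i j. i < n \<and> j < n}"
    using submatrix_remove_one[OF A] by (auto simp: set_eq_iff) (metis+)
  finally show ?thesis .
qed

text \<open>Adjugate entries are these minors, transposed and up to signs, which do not affect
  divisibility.\<close>

lemma dvd_minors_pred_iff_dvd_adj_mat:
  fixes A :: "'a::idom mat"
  assumes A: "A \<in> carrier_mat n n" and n: "n > 0"
  shows "(\<forall>s\<in>minors (n - 1) A. e dvd s) \<longleftrightarrow> (\<forall>i<n. \<forall>j<n. e dvd adj_mat A $$ (i, j))"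
proof -
  have "e dvd (-1) ^ k * x \<longleftrightarrow> e dvd x" for k :: nat and x :: 'a
    by (cases "even k") auto
  then have "e dvd adj_mat A $$ (i, j) \<longleftrightarrow> e dvd det (mat_delete A j i)" if "i < n" "j < n" for i j
    using A that by (simp add: adj_mat_def cofactor_def)
  then show ?thesis
    unfolding minors_pred[OF assms] by blast
qed

text \<open>The predicate under \<open>SOME\<close> depends only on the common divisors, so the two
  choices are literally equal, not merely associated.\<close>

lemma gcd_of_cong:
  assumes "\<And>e. (\<forall>s\<in>S. e dvd s) \<longleftrightarrow> (\<forall>s\<in>T. e dvd s)"
  shows "gcd_of S = gcd_of T"
  using assms by (simp add: gcd_of_def is_gcd_of_def)

section \<open>Identifying the adjugate with \<open>q\<close> evaluated at the companion
  matrix\<close>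

lemma det_represents_nonzero:
  fixes f g :: "'a::idom poly"
  assumes edd: "elementary_divisor_domain TYPE('a)" and monic: "lead_coeff g = 1"
    and coprime: "coprime_polys f g" and n: "degree g > 0" and A: "represents g A f"
  shows "det A \<noteq> 0"
proof
  let ?n = "degree g"
  assume "det A = 0"
  have Ac: "A \<in> carrier_mat ?n ?n" using A by (simp add: represents_def)
  \<comment> \<open>Row vectors encode polynomials, so a left kernel vector is wanted; it is turned
    into the one-row matrix \<open>M\<close>.\<close>
  then have "det (transpose_mat A) = 0" using \<open>det A = 0\<close> det_transpose by metis
  then obtain v where v: "v \<in> carrier_vec ?n" "v \<noteq> 0\<^sub>v ?n" "transpose_mat A *\<^sub>v v = 0\<^sub>v ?n"
    using det_0_iff_vec_prod_zero[of "transpose_mat A" ?n] Ac by auto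
  define M where "M = mat 1 ?n (\<lambda>(i, j). vec_index v j)"
  have Mc: "M \<in> carrier_mat 1 ?n" by (simp add: M_def)
  have "(M * A) $$ (0, j) = 0" if "j < ?n" for j
  proof -
    have "(M * A) $$ (0, j) = vec_index (transpose_mat A *\<^sub>v v) j"
      using that Ac v(1) by (auto simp: M_def scalar_prod_def mult.commute intro!: sum.cong)
    then show ?thesis using v that by simp
  qed
  then have "row_poly (M * A) 0 = 0"
    using Ac Mc by (simp add: row_poly_def)
  then have "g dvd f * row_poly M 0"
    using row_poly_mult_represents[OF Mc A, of 0] by simp
  moreover have "row_poly M 0 \<noteq> 0"
  proof
    assume "row_poly M 0 = 0"
    then have "vec_index v j = 0" if "j < ?n" for j
      using coeff_row_poly[of j M 0] that by (simp add: M_def)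
    with v show False by auto
  qed
  moreover have "degree (row_poly M 0) < ?n"
    using degree_row_poly[of M 0] Mc n by simp
  ultimately show False
    using common_divisor_of_annihilator[OF edd monic] coprime by blast
qed

text \<open>The congruence says that \<open>S * A\<close> is the scalar matrix \<open>det A\<close>.
  Multiplying by the adjugate on the right and cancelling the nonzero \<open>det A\<close> entrywise
  leaves \<open>S\<close>.\<close>

lemma represents_inverse_eq_adj_mat:
  fixes f g q :: "'a::idom poly"
  assumes A: "represents g A f" and S: "represents g S q" and n: "degree g > 0"
    and q: "g dvd f * q - [:det A:]" and det: "det A \<noteq> 0"
  shows "S = adj_mat A"
proof -
  let ?n = "degree g" and ?Q = "adj_mat A"
  have Ac: "A \<in> carrier_mat ?n ?n" and Sc: "S \<in> carrier_mat ?n ?n"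
    using A S by (auto simp: represents_def)
  note Q = adj_mat[OF Ac]
  have "S * A = det A \<cdot>\<^sub>m 1\<^sub>m ?n"
    by (rule represents_unique[OF represents_mult[OF S A] represents_smult_one q n])
  then have "(S * A) * ?Q = det A \<cdot>\<^sub>m ?Q"
    using Q(1) by (simp add: mult_smult_assoc_mat[OF one_carrier_mat Q(1)])
  moreover have "(S * A) * ?Q = S * (A * ?Q)"
    using Sc Ac Q by (simp add: assoc_mult_mat)
  moreover have "S * (A * ?Q) = det A \<cdot>\<^sub>m S"
    by (simp only: Q(2) mult_smult_distrib[OF Sc one_carrier_mat] right_mult_one_mat[OF Sc])
  ultimately have eq: "det A \<cdot>\<^sub>m S = det A \<cdot>\<^sub>m ?Q" by simp
  show ?thesis
  proof (rule eq_matI)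
    fix i j assume "i < dim_row ?Q" "j < dim_col ?Q"
    with arg_cong[OF eq, of "\<lambda>M. M $$ (i, j)"] show "S $$ (i, j) = ?Q $$ (i, j)"
      using Sc Q det by simp
  qed (use Sc Q in auto)
qed

lemma dvd_eval_companion_mat_iff:
  fixes g q :: "'a::idom poly"
  assumes monic: "lead_coeff g = 1" and deg: "degree q < degree g"
  shows "(\<forall>i<degree g. \<forall>j<degree g. e dvd eval_poly_mat q (companion_mat g) $$ (i, j)) \<longleftrightarrow>
    (\<forall>s\<in>set (coeffs q). e dvd s)"
proof -
  let ?n = "degree g" and ?S = "eval_poly_mat q (companion_mat g)"
  have S: "represents g ?S q" by (rule represents_eval_poly_mat[OF monic])
  then have Sc: "?S \<in> carrier_mat ?n ?n" by (simp add: represents_def)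
  \<comment> \<open>The last row stands for \<open>q\<close> times t^0, and \<open>deg\<close> turns
    the congruence into an equality.\<close>
  have "row_poly ?S (?n - 1) = q"
  proof (rule dvd_degree_less_imp_eq)
    show "g dvd row_poly ?S (?n - 1) - q"
      using S deg unfolding represents_def by (auto dest!: spec[of _ "?n - 1"] simp: monom_0)
    show "degree (row_poly ?S (?n - 1)) < ?n"
      using degree_row_poly[of ?S] Sc deg by simp
  qed (rule deg)
  then have last: "coeff q k = ?S $$ (?n - 1, ?n - Suc k)" if "k < ?n" for k
    using coeff_row_poly[of "?n - Suc k" ?S "?n - 1"] Sc that by simp
  show ?thesis
  proof
    assume *: "\<forall>i<?n. \<forall>j<?n. e dvd ?S $$ (i, j)"
    show "\<forall>s\<in>set (coeffs q). e dvd s"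
    proof
      fix s assume "s \<in> set (coeffs q)"
      then have "\<exists>k\<le>degree q. s = coeff q k"
        by (auto simp: coeffs_def less_Suc_eq_le simp del: upt_Suc split: if_splits)
      then obtain k where "k \<le> degree q" "s = coeff q k"
        by blast
      then show "e dvd s" using last[of k] * deg by simp
    qed
  next
    assume *: "\<forall>s\<in>set (coeffs q). e dvd s"
    have "e dvd coeff q k" for k
      using * coeff_in_coeffs[of q k] by (cases "q = 0 \<or> k > degree q") (auto simp: coeff_eq_0)
    moreover have "dim_row (companion_mat g) = ?n"
      by (simp add: companion_mat_def Let_def)
    ultimately show "\<forall>i<?n. \<forall>j<?n. e dvd ?S $$ (i, j)"
      by (auto simp: eval_poly_mat_def intro!: dvd_sum)
  qed
qed

section \<open>The determinantal divisor and the content\<close>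

theorem theorem3p8:
  fixes f g :: "'a::idom poly" and n :: nat
  assumes "elementary_divisor_domain TYPE('a)"
    and "coprime_polys f g"
    and "lead_coeff g = 1" and "degree g = n" and "n \<ge> 1"
  shows "(\<exists>!q. degree q < n \<and> g dvd (f * q - [:Res f g:])) \<and>
    (\<forall>q. degree q < n \<and> g dvd (f * q - [:Res f g:]) \<longrightarrow>
      eq_up_to_unit (det_divisor (n - 1) (eval_poly_mat f (companion_mat g))) (cont q) \<and>
      (eq_up_to_unit (det_divisor (n - 1) (eval_poly_mat f (companion_mat g))) 1
        \<longleftrightarrow> primitive_poly q))"
proof (intro conjI allI impI)
  note monic = assms(3)
  let ?A = "eval_poly_mat f (companion_mat g)"
  have n: "degree g > 0" using assms by simp
  have A: "represents g ?A f" by (rule represents_eval_poly_mat[OF monic])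
  then have Ac: "?A \<in> carrier_mat n n" using assms by (simp add: represents_def)
  have Res: "Res f g = det ?A" by (rule Res_eq_det[OF monic n A])
  show "\<exists>!q. degree q < n \<and> g dvd (f * q - [:Res f g:])"
  proof (rule ex_ex1I)
    \<comment> \<open>The witness is the last row of the adjugate: multiplied by \<open>?A\<close>
      it becomes the last row of the scalar matrix \<open>det ?A\<close>, which encodes the constant
      polynomial.\<close>
    let ?Q = "adj_mat ?A" and ?i = "n - 1"
    note Q = adj_mat[OF Ac]
    have "g dvd row_poly (?Q * ?A) ?i - f * row_poly ?Q ?i"
      using Q(1) assms by (intro row_poly_mult_represents[OF _ A]) auto
    moreover have "g dvd row_poly (?Q * ?A) ?i - [:det ?A:]"
      using represents_smult_one[of g "det ?A"] assms n unfolding Q(3) represents_def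
      by (auto dest!: spec[of _ ?i] simp: monom_0)
    ultimately have "g dvd (row_poly (?Q * ?A) ?i - [:det ?A:]) -
         (row_poly (?Q * ?A) ?i - f * row_poly ?Q ?i)"
      by (rule dvd_diff[rotated])
    moreover have "(x - d) - (x - y) = y - d" for x y d :: "'a poly"
      by simp
    ultimately have "g dvd f * row_poly ?Q ?i - [:Res f g:]"
      by (simp only: Res)
    moreover have "degree (row_poly ?Q ?i) < n"
      using degree_row_poly[of ?Q ?i] Q(1) assms by simp
    ultimately show "\<exists>q. degree q < n \<and> g dvd (f * q - [:Res f g:])" by blast
  next
    fix p q assume p: "degree p < n \<and> g dvd (f * p - [:Res f g:])"
      and q: "degree q < n \<and> g dvd (f * q - [:Res f g:])"
    have "g dvd (f * p - [:Res f g:]) - (f * q - [:Res f g:])"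
      using p q by (meson dvd_diff)
    then have "g dvd f * (p - q)" by (simp add: algebra_simps)
    moreover have "degree (p - q) < degree g"
      using p q assms by (intro degree_diff_less) auto
    ultimately have "p - q = 0"
      using common_divisor_of_annihilator[OF assms(1) monic] assms(2) by blast
    then show "p = q" by simp
  qed
  fix q assume q: "degree q < n \<and> g dvd (f * q - [:Res f g:])"
  have adj: "eval_poly_mat q (companion_mat g) = adj_mat ?A"
    using q by (intro represents_inverse_eq_adj_mat[OF A represents_eval_poly_mat[OF monic] n]
        det_represents_nonzero[OF assms(1) monic assms(2) n A]) (simp add: Res)
  have "(\<forall>s\<in>minors (n - 1) ?A. e dvd s) \<longleftrightarrow> (\<forall>s\<in>set (coeffs q). e dvd s)" for e
    using dvd_minors_pred_iff_dvd_adj_mat[OF Ac, of e] dvd_eval_companion_mat_iff[OF monic, of q e]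
      q assms by (simp add: adj)
  then have cont: "gcd_of (minors (n - 1) ?A) = cont q"
    unfolding cont_def by (rule gcd_of_cong)
  show eq: "eq_up_to_unit (det_divisor (n - 1) ?A) (cont q)"
  \<comment> \<open>For \<open>n = 1\<close>, \<open>det_divisor\<close> is 1 by convention, whereas
    \<open>cont q\<close> is a chosen gcd of the set {1}, hence some unit. For larger
    \<open>n\<close> the two sides are equal.\<close>
  proof (cases "n = 1")
    case True
    have "minors 0 ?A = {1}"
      using minors_pred[OF Ac] mat_delete_carrier[OF Ac] True by auto
    moreover have "is_gcd_of (1 :: 'a) {1}" by (simp add: is_gcd_of_def)
    ultimately have "is_gcd_of (cont q) {1}"
      using True unfolding cont[symmetric] gcd_of_def by (auto intro: someI)
    then have "cont q dvd 1" by (simp add: is_gcd_of_def)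
    then obtain k where "1 = k * cont q" by (auto elim!: dvdE simp: mult.commute)
    then have "k dvd 1 \<and> 1 = k * cont q" by (metis dvd_triv_left)
    then show ?thesis
      using True by (auto simp: det_divisor_def eq_up_to_unit_def)
  next
    case False
    then have "det_divisor (n - 1) ?A = 1 * cont q"
      using cont assms by (simp add: det_divisor_def)
    then show ?thesis
      unfolding eq_up_to_unit_def by (metis dvd_refl)
  qed
  show "eq_up_to_unit (det_divisor (n - 1) ?A) 1 \<longleftrightarrow> primitive_poly q"
    using eq by (auto simp: eq_up_to_unit_def primitive_poly_def is_unit_mult_iff)
qed

end
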